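(* Let $f:\mathbb{R}_{\ge 0}\to[0,1]$ be a sigmoidal function with inflection point $t_{\text{inf}}$, let $N\in\mathbb{N}$ and $c>0$. For the optimization problem $$\text{maximize}_{\boldsymbol t\in\mathbb{R}^N_{\ge0}}\ \frac1N\sum_{\ell=1}^N\big(f(t_\ell)-c\,t_\ell\,(N-\ell+1)\big),$$ the optimal allocation at stage $\ell\in\{1,\dots,N\}$ is $$t^*_\ell=\operatorname{argmax}_{\beta\in\{0,\,t^\dagger_\ell\}}\big(f(\beta)-c(N-\ell+1)\beta\big)$$ (i.e. an element of $\{0,t^\dagger_\ell\}$ maximizing this expression), where $$t^\dagger_\ell=\begin{cases}0,&\text{if } f'(t_{\text{inf}})<c(N-\ell+1),\\ \max\{t\in\mathbb{R}_{>0}\mid f'(t)=c(N-\ell+1)\},&\text{otherwise.}\end{cases}$$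
   Context: A function $f:\mathbb{R}_{\ge0}\to\mathbb{R}_{\ge0}$ is sigmoidal if it is smooth and of the form $f(t)=f_{\text{cvx}}(t)\,\mathcal{I}(t<t_{\text{inf}})+f_{\text{cnv}}(t)\,\mathcal{I}(t\ge t_{\text{inf}})$, where $\mathcal{I}$ is the indicator, $f_{\text{cvx}}$ and $f_{\text{cnv}}$ are monotonically increasing convex and concave functions, respectively, and $t_{\text{inf}}$ is the inflection point. The derivative $f'$ is unimodal with maximum at $t_{\text{inf}}$, $f'(0)\ge 0$, $\lim_{t\to\infty}f'(t)=0$ and $\lim_{t\to\infty}f''(t)=0$. *)

theory Defs
  imports "HOL-Analysis.Analysis"
begin

text \<open>
  A function on the half-line is represented by a total function on the reals of which only the
  values on \<open>{0..}\<close> matter; accordingly, derivatives are taken within \<open>{0..}\<close>, hence one-sided at 0.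
\<close>

definition hderiv :: "(real \<Rightarrow> real) \<Rightarrow> real \<Rightarrow> real" where
  "hderiv f t = vector_derivative f (at t within {0..})"

definition smooth_half_line :: "(real \<Rightarrow> real) \<Rightarrow> bool" where
  "smooth_half_line f \<longleftrightarrow> (\<forall>n. (hderiv ^^ n) f differentiable_on {0..})"

text \<open>
  Monotonicity and unimodality are not required to be strict, and \<open>tinf = 0\<close> (no convex part) is
  allowed.
\<close>

definition sigmoidal :: "(real \<Rightarrow> real) \<Rightarrow> real \<Rightarrow> bool" where
  "sigmoidal f tinf \<longleftrightarrow>
     f \<in> {0..} \<rightarrow> {0..} \<and> 0 \<le> tinf \<and> smooth_half_line f \<and>
     (\<exists>fcvx fcnv.
        mono_on {0..} fcvx \<and> convex_on {0..} fcvx \<and>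
        mono_on {0..} fcnv \<and> concave_on {0..} fcnv \<and>
        (\<forall>t\<ge>0. f t = fcvx t * indicat_real {..<tinf} t + fcnv t * indicat_real {tinf..} t)) \<and>
     mono_on {0..tinf} (hderiv f) \<and> antimono_on {tinf..} (hderiv f) \<and>
     0 \<le> hderiv f 0 \<and>
     (hderiv f \<longlongrightarrow> 0) at_top \<and>
     (hderiv (hderiv f) \<longlongrightarrow> 0) at_top"

definition stage_cost :: "real \<Rightarrow> nat \<Rightarrow> nat \<Rightarrow> real" where
  "stage_cost c N l = c * (real N - real l + 1)"

text \<open>The set \<open>\<real>\<^sup>N\<close> is represented by functions on \<open>{1..N}\<close>, values outside being irrelevant.\<close>

definition allocations :: "nat \<Rightarrow> (nat \<Rightarrow> real) set" where
  "allocations N = {1..N} \<rightarrow> {0..}"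

definition objective :: "(real \<Rightarrow> real) \<Rightarrow> real \<Rightarrow> nat \<Rightarrow> (nat \<Rightarrow> real) \<Rightarrow> real" where
  "objective f c N t = 1 / real N * (\<Sum>l = 1..N. f (t l) - stage_cost c N l * t l)"

text \<open>
  The maximum of the empty set is read as 0. For sigmoidal \<open>f\<close> and \<open>k > 0\<close> with
  \<open>k \<le> hderiv f tinf\<close>, the set \<open>{t. 0 < t \<and> hderiv f t = k}\<close> can only be empty if
  \<open>tinf = 0\<close> and \<open>hderiv f 0 = k\<close>; otherwise it has a greatest element by the intermediate value
  theorem, so this convention does not apply when \<open>tinf > 0\<close>.
\<close>

definition t_dagger :: "(real \<Rightarrow> real) \<Rightarrow> real \<Rightarrow> real \<Rightarrow> real" where
  "t_dagger f tinf k =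
     (if hderiv f tinf < k then 0
      else if {t. 0 < t \<and> hderiv f t = k} = {} then 0
      else (GREATEST t. 0 < t \<and> hderiv f t = k))"

end

theory Submission
  imports Defs
begin

text \<open>
  The objective separates into one problem per stage: maximize \<open>f \<beta> - k * \<beta>\<close> over \<open>\<beta> \<ge> 0\<close>, where
  \<open>k > 0\<close>. If \<open>f' \<le> k\<close> everywhere, the maximizer is 0. Otherwise let \<open>d\<close> be the last solution of
  \<open>f' = k\<close>. It lies in the decreasing phase of \<open>f'\<close>, so \<open>f' \<le> k\<close> beyond \<open>d\<close>. A point \<open>\<beta> < d\<close> either
  lies in the increasing phase with \<open>f' \<le> k\<close> on all of \<open>[0, \<beta>]\<close>, and moving to 0 does not lower the
  value, or has \<open>f' \<ge> k\<close> on all of \<open>[\<beta>, d]\<close>, and moving to \<open>d\<close> does not lower it.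
\<close>

lemma has_real_derivative_hderiv:
  assumes "f differentiable_on {0..}" "0 \<le> x"
  shows "(f has_real_derivative hderiv f x) (at x within {0..})"
  using assms
  by (simp add: differentiable_on_def hderiv_def has_real_derivative_iff_has_vector_derivative
      vector_derivative_works)

text \<open>On \<open>{a..b}\<close> the derivative within \<open>{0..}\<close> restricts to the one
  within \<open>{a..b}\<close>, so \<open>a = 0\<close> needs no separate treatment.\<close>

lemma hderiv_mean_value:
  fixes f :: "real \<Rightarrow> real"
  assumes "f differentiable_on {0..}" "0 \<le> a" "a < b"
  obtains z where "a < z" "z < b" "f b - f a = hderiv f z * (b - a)"
proof -
  have "\<exists>z\<in>{a<..<b}. f b - f a = hderiv f z * (b - a)"
  proof (rule mvt_simple[OF \<open>a < b\<close>])
    fix x assume "a \<le> x" "x \<le> b"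
    then have "(f has_real_derivative hderiv f x) (at x within {a..b})"
      using has_real_derivative_hderiv[OF assms(1), of x] \<open>0 \<le> a\<close>
      by (auto intro: DERIV_subset)
    then show "(f has_derivative (*) (hderiv f x)) (at x within {a..b})"
      by (simp add: has_field_derivative_def)
  qed
  then show thesis using that by auto
qed

lemma hderiv_le_imp_linear_bound:
  fixes f :: "real \<Rightarrow> real"
  assumes "f differentiable_on {0..}" "0 \<le> a" "a \<le> b"
    and "\<And>x. a < x \<Longrightarrow> x < b \<Longrightarrow> hderiv f x \<le> k"
  shows "f b - k * b \<le> f a - k * a"
proof (cases "a = b")
  case False
  then obtain z where z: "a < z" "z < b" "f b - f a = hderiv f z * (b - a)"
    using hderiv_mean_value[OF assms(1,2), of b] assms(3) by (metis order_le_less)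
  then have "f b - f a \<le> k * (b - a)"
    using assms(3,4) by (simp add: mult_right_mono)
  then show ?thesis by (simp add: algebra_simps)
qed simp

lemma hderiv_ge_imp_linear_bound:
  fixes f :: "real \<Rightarrow> real"
  assumes "f differentiable_on {0..}" "0 \<le> a" "a \<le> b"
    and "\<And>x. a < x \<Longrightarrow> x < b \<Longrightarrow> k \<le> hderiv f x"
  shows "f a - k * a \<le> f b - k * b"
proof (cases "a = b")
  case False
  then obtain z where z: "a < z" "z < b" "f b - f a = hderiv f z * (b - a)"
    using hderiv_mean_value[OF assms(1,2), of b] assms(3) by (metis order_le_less)
  then have "k * (b - a) \<le> f b - f a"
    using assms(3,4) by (simp add: mult_right_mono)
  then show ?thesis by (simp add: algebra_simps)
qed simp

text \<open>The limit 0 keeps the level set of \<open>k > 0\<close> bounded and continuity keeps it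
  closed, so a maximum is attained. This justifies the \<open>GREATEST\<close> in
  \<open>t_dagger\<close>.\<close>

lemma continuous_last_level_point:
  fixes h :: "real \<Rightarrow> real"
  assumes "continuous_on {0..} h" "(h \<longlongrightarrow> 0) at_top" "0 < k" "0 < s" "h s = k"
  obtains d where "0 < d" "h d = k" "\<And>x. 0 < x \<Longrightarrow> h x = k \<Longrightarrow> x \<le> d"
proof -
  obtain T where T: "\<And>x. T \<le> x \<Longrightarrow> h x < k"
    using order_tendstoD(2)[OF assms(2,3)] by (auto simp: eventually_at_top_linorder)
  \<comment> \<open>Cutting at \<open>s\<close> instead of 0 makes the set closed despite the strict
    condition \<open>0 < x\<close>; solutions left of \<open>s\<close> cannot be the last
    one.\<close>
  define A where "A = {x \<in> {s..T}. h x = k}"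
  have "continuous_on {s..T} h"
    using assms(1,4) by (auto intro: continuous_on_subset)
  then have "closed A"
    unfolding A_def by (intro continuous_closed_preimage_constant) auto
  moreover have "A \<subseteq> {s..T}" by (auto simp: A_def)
  ultimately have "compact A"
    by (meson compact_eq_bounded_closed bounded_subset bounded_closed_interval)
  moreover have "s \<in> A"
    using assms(5) T[of s] by (cases "s \<le> T") (auto simp: A_def)
  ultimately obtain d where d: "d \<in> A" "\<And>x. x \<in> A \<Longrightarrow> x \<le> d"
    using compact_attains_sup by (metis empty_iff)
  show thesis
  proof
    show "0 < d" "h d = k" using d(1) assms(4) by (auto simp: A_def)
    fix x assume "0 < x" "h x = k"
    show "x \<le> d"
    proof (cases "s \<le> x")
      case True
      then have "x \<in> A" using \<open>h x = k\<close> T[of x] by (cases "x \<le> T") (auto simp: A_def)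
      then show ?thesis by (rule d(2))
    next
      case False
      then show ?thesis using d(2)[OF \<open>s \<in> A\<close>] by simp
    qed
  qed
qed

text \<open>Intermediate value theorem between \<open>a\<close> and a point where \<open>h\<close>
  has dropped below \<open>k\<close>; \<open>max a T\<close> covers the case
  \<open>T < a\<close>.\<close>

lemma continuous_level_attained_beyond:
  fixes h :: "real \<Rightarrow> real"
  assumes "continuous_on {0..} h" "(h \<longlongrightarrow> 0) at_top" "0 < k" "0 \<le> a" "k \<le> h a"
  obtains x where "a \<le> x" "h x = k"
proof -
  obtain T where T: "\<And>x. T \<le> x \<Longrightarrow> h x < k"
    using order_tendstoD(2)[OF assms(2,3)] by (auto simp: eventually_at_top_linorder)
  have "\<exists>x. a \<le> x \<and> x \<le> max a T \<and> h x = k"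
  proof (rule IVT2')
    show "h (max a T) \<le> k" using T[of "max a T"] by simp
    show "continuous_on {a..max a T} h"
      using assms(1,4) by (auto intro: continuous_on_subset)
  qed (use assms in auto)
  then show thesis using that by blast
qed

text \<open>The single-stage problem for an arbitrary slope \<open>k\<close>; \<open>f 0\<close> is
  the value of the stage objective at 0.\<close>

lemma sigmoidal_stage_bound:
  assumes sig: "sigmoidal f tinf" and "0 < k" "0 \<le> b"
  defines "d \<equiv> t_dagger f tinf k"
  shows "0 \<le> d" "f b - k * b \<le> max (f 0) (f d - k * d)"
proof -
  have smooth: "\<And>n. (hderiv ^^ n) f differentiable_on {0..}" and "0 \<le> tinf"
    and mono: "mono_on {0..tinf} (hderiv f)" and anti: "antimono_on {tinf..} (hderiv f)"
    and lim: "(hderiv f \<longlongrightarrow> 0) at_top"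
    using sig by (auto simp: sigmoidal_def smooth_half_line_def)
  have diff: "f differentiable_on {0..}" using smooth[of 0] by simp
  have cont: "continuous_on {0..} (hderiv f)"
    using differentiable_imp_continuous_on[OF smooth[of 1]] by simp
  have inc: "hderiv f x \<le> hderiv f y" if "0 \<le> x" "x \<le> y" "y \<le> tinf" for x y
    using monotone_onD[OF mono, of x y] that by auto
  have dec: "hderiv f y \<le> hderiv f x" if "tinf \<le> x" "x \<le> y" for x y
    using monotone_onD[OF anti, of x y] that by auto
  have peak: "hderiv f x \<le> hderiv f tinf" if "0 \<le> x" for x
    using inc[of x tinf] dec[of tinf x] that by (cases "x \<le> tinf") auto
  \<comment> \<open>Stated with \<open>\<le>\<close> so that it serves both a peak below
    \<open>k\<close> and a peak equal to \<open>k\<close> with no positive solution.\<close>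
  have flat: "f b - k * b \<le> f 0" if "hderiv f tinf \<le> k"
  proof -
    have "hderiv f x \<le> k" if "0 < x" for x
      using peak[of x] that \<open>hderiv f tinf \<le> k\<close> by simp
    then show ?thesis
      using hderiv_le_imp_linear_bound[OF diff order.refl \<open>0 \<le> b\<close>, of k] by simp
  qed
  have "0 \<le> d \<and> f b - k * b \<le> max (f 0) (f d - k * d)"
  proof (cases "hderiv f tinf < k")
    case True
    then show ?thesis using flat by (simp add: d_def t_dagger_def)
  next
    case False
    obtain x where x: "tinf \<le> x" "hderiv f x = k"
      using continuous_level_attained_beyond[OF cont lim \<open>0 < k\<close> \<open>0 \<le> tinf\<close>] False by auto
    show ?thesis
    proof (cases "{t. 0 < t \<and> hderiv f t = k} = {}")
      case True
      \<comment> \<open>With no positive solution, \<open>x\<close> and hence \<open>tinf\<close>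
        must be 0, so the peak value is exactly \<open>k\<close> and the default value 0 of
        \<open>t_dagger\<close> is optimal.\<close>
      then have "\<not> 0 < x" using x(2) by blast
      then have "hderiv f tinf = k" using x \<open>0 \<le> tinf\<close> by (cases "x = tinf") auto
      moreover have "d = 0" using True False by (simp add: d_def t_dagger_def)
      ultimately show ?thesis using flat by simp
    next
      case nonempty: False
      then obtain s where "0 < s" "hderiv f s = k" by auto
      then obtain m where m: "0 < m" "hderiv f m = k"
        "\<And>x. 0 < x \<Longrightarrow> hderiv f x = k \<Longrightarrow> x \<le> m"
        using continuous_last_level_point[OF cont lim \<open>0 < k\<close>] by metis
      have "(GREATEST t. 0 < t \<and> hderiv f t = k) = m"
        using m by (intro Greatest_equality) auto
      then have "d = m" using nonempty False unfolding d_def t_dagger_def by argo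
      with m have d: "0 < d" "hderiv f d = k" "\<And>x. 0 < x \<Longrightarrow> hderiv f x = k \<Longrightarrow> x \<le> d"
        by auto
      \<comment> \<open>If \<open>x > 0\<close>, then \<open>tinf \<le> x \<le> d\<close> because
        \<open>d\<close> is the last solution; otherwise \<open>tinf = 0\<close>.\<close>
      have "tinf \<le> d" using d(1) d(3)[of x] x by (cases "0 < x") auto
      consider "d \<le> b" | "b < d" "b \<le> tinf" "hderiv f b \<le> k"
        | "b < d" "b \<le> tinf" "k \<le> hderiv f b" | "b < d" "tinf < b"
        by linarith
      then have "f b - k * b \<le> f 0 \<or> f b - k * b \<le> f d - k * d"
      proof cases
        case 1
        have "f b - k * b \<le> f d - k * d"
        proof (rule hderiv_le_imp_linear_bound[OF diff _ 1])
          fix y assume "d < y"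
          then show "hderiv f y \<le> k" using dec[of d y] d(2) \<open>tinf \<le> d\<close> by simp
        qed (use d in simp)
        then show ?thesis ..
      next
        case 2
        have "f b - k * b \<le> f 0 - k * 0"
        proof (rule hderiv_le_imp_linear_bound[OF diff order.refl \<open>0 \<le> b\<close>])
          fix y assume "0 < y" "y < b"
          then show "hderiv f y \<le> k" using inc[of y b] 2 by simp
        qed
        then show ?thesis by simp
      next
        case 3
        have "f b - k * b \<le> f d - k * d"
        proof (rule hderiv_ge_imp_linear_bound[OF diff \<open>0 \<le> b\<close>])
          fix y assume "b < y" "y < d"
          then show "k \<le> hderiv f y"
            \<comment> \<open>Up to \<open>tinf\<close> the derivative is at least its value at
              \<open>b\<close>, afterwards at least its value \<open>k\<close> at
              \<open>d\<close>.\<close>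
            using inc[of b y] dec[of y d] 3 d(2) \<open>0 \<le> b\<close> by (cases "y \<le> tinf") auto
        qed (use 3 in simp)
        then show ?thesis ..
      next
        case 4
        have "f b - k * b \<le> f d - k * d"
        proof (rule hderiv_ge_imp_linear_bound[OF diff \<open>0 \<le> b\<close>])
          fix y assume "b < y" "y < d"
          then show "k \<le> hderiv f y" using dec[of y d] 4 d(2) by simp
        qed (use 4 in simp)
        then show ?thesis ..
      qed
      then show ?thesis using d(1) by auto
    qed
  qed
  then show "0 \<le> d" "f b - k * b \<le> max (f 0) (f d - k * d)" by auto
qed

theorem theorem4:
  fixes f :: "real \<Rightarrow> real" and tinf c :: real and N :: nat and t :: "nat \<Rightarrow> real"
  assumes "sigmoidal f tinf"
    and "f \<in> {0..} \<rightarrow> {0..1}"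
    and "N \<ge> 1"
    and "c > 0"
    and "\<forall>l\<in>{1..N}.
           is_arg_max (\<lambda>\<beta>. f \<beta> - stage_cost c N l * \<beta>)
             (\<lambda>\<beta>. \<beta> \<in> {0, t_dagger f tinf (stage_cost c N l)}) (t l)"
  shows "is_arg_max (objective f c N) (\<lambda>s. s \<in> allocations N) t"
proof -
  have stage: "0 \<le> t l \<and> f b - stage_cost c N l * b \<le> f (t l) - stage_cost c N l * t l"
    if l: "l \<in> {1..N}" and "0 \<le> b" for l b
  proof -
    let ?k = "stage_cost c N l"
    \<comment> \<open>Since \<open>l \<le> N\<close>, the factor of \<open>c\<close> is at least
      1.\<close>
    have "0 < ?k" using l \<open>c > 0\<close> by (simp add: stage_cost_def)
    note bound = sigmoidal_stage_bound[OF assms(1) this \<open>0 \<le> b\<close>]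
    have "t l \<in> {0, t_dagger f tinf ?k}"
      and best: "\<And>\<beta>. \<beta> \<in> {0, t_dagger f tinf ?k} \<Longrightarrow> f \<beta> - ?k * \<beta> \<le> f (t l) - ?k * t l"
      using assms(5) l unfolding is_arg_max_def by (auto simp: not_less)
    then show ?thesis
      using bound best[of 0] best[of "t_dagger f tinf ?k"] by auto
  qed
  \<comment> \<open>Feasibility is the first half of \<open>stage\<close>, taken at
    \<open>b = 0\<close>.\<close>
  have "t \<in> allocations N"
    using stage[OF _ order.refl] by (auto simp: allocations_def)
  moreover have "objective f c N s \<le> objective f c N t" if "s \<in> allocations N" for s
    unfolding objective_def
  proof (intro mult_left_mono sum_mono)
    fix l assume l: "l \<in> {1..N}"
    then have "0 \<le> s l" using that by (auto simp: allocations_def)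
    with l show "f (s l) - stage_cost c N l * s l \<le> f (t l) - stage_cost c N l * t l"
      using stage by blast
  qed simp
  ultimately show ?thesis by (auto simp: is_arg_max_def not_less)
qed

end
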